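(* Let $x_{1d}\le x_{2d}\le\dots\le x_{nd}$ be real numbers. For any nonnegative vector $\lambda\in\mathbb{R}^n$ and any $p\in[1,\infty)$, the set $\mathcal A\cup\mathcal A_c$ always contains a $(\lambda,p)$-ordered median point, where $\mathcal A$ and $\mathcal A_c$ are the sets defined in the context.
   Context: For $\beta_0\in\mathbb{R}$ put $\varepsilon_i(\beta_0)=|x_{id}-\beta_0|$, let $\varepsilon_{(1)}(\beta_0)\le\dots\le\varepsilon_{(n)}(\beta_0)$ be these values sorted in nondecreasing order, and set $f_{\lambda,p}(\beta_0)=\sum_{i=1}^n\lambda_i\,\varepsilon_{(i)}(\beta_0)^p$. A $(\lambda,p)$-ordered median point is a global minimizer of $f_{\lambda,p}$ over $\mathbb{R}$. $\mathcal A$ is the set consisting of all $x_{id}$, $i=1,\dots,n$, together with all midpoints $\alpha_{ik}=\frac{x_{id}+x_{kd}}2$ ($1\le i<k\le n$) lying in the open interval $(x_{1d},x_{nd})$. $\mathcal A_c$ is the set of all critical points of $f_{\lambda,p}$ in $(x_{1d},x_{nd})$, i.e. points at which $f_{\lambda,p}$ is differentiable with zero derivative. *)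

theory Defs
  imports Complex_Main
begin

(* Families x_1, ..., x_n are functions on nat; only the values at 1, ..., n are relevant. *)

(* "sorted_dist n x b i" is the i-th smallest (1 <= i <= n, with multiplicity) of the
   distances |x_j - b|; list positions start at 0, hence the shift. *)
definition sorted_dist :: "nat \<Rightarrow> (nat \<Rightarrow> real) \<Rightarrow> real \<Rightarrow> nat \<Rightarrow> real" where
  "sorted_dist n x b i = sort (map (\<lambda>j. \<bar>x j - b\<bar>) [1..<Suc n]) ! (i - 1)"

(* The base of powr is nonnegative and "0 powr p = 0", so for p >= 1 this is the usual power. *)
definition ordered_median_fun ::
    "nat \<Rightarrow> (nat \<Rightarrow> real) \<Rightarrow> (nat \<Rightarrow> real) \<Rightarrow> real \<Rightarrow> real \<Rightarrow> real" where
  "ordered_median_fun n x lam p b = (\<Sum>i = 1..n. lam i * sorted_dist n x b i powr p)"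

definition is_ordered_median_point ::
    "nat \<Rightarrow> (nat \<Rightarrow> real) \<Rightarrow> (nat \<Rightarrow> real) \<Rightarrow> real \<Rightarrow> real \<Rightarrow> bool" where
  "is_ordered_median_point n x lam p b \<longleftrightarrow>
     (\<forall>b'. ordered_median_fun n x lam p b \<le> ordered_median_fun n x lam p b')"

definition data_and_midpoints :: "nat \<Rightarrow> (nat \<Rightarrow> real) \<Rightarrow> real set" where
  "data_and_midpoints n x =
     x ` {1..n} \<union>
     {(x i + x k) / 2 | i k. 1 \<le> i \<and> i < k \<and> k \<le> n \<and> (x i + x k) / 2 \<in> {x 1<..<x n}}"

definition critical_points ::
    "nat \<Rightarrow> (nat \<Rightarrow> real) \<Rightarrow> (nat \<Rightarrow> real) \<Rightarrow> real \<Rightarrow> real set" where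
  "critical_points n x lam p =
     {b \<in> {x 1<..<x n}. (ordered_median_fun n x lam p has_real_derivative 0) (at b)}"

end

theory Submission
  imports Defs "HOL-Library.Multiset"
begin

text \<open>
  The objective is continuous, because order statistics are monotone and hence 1-Lipschitz in the
  supremum norm. Moving a point outside \<open>[x 1, x n]\<close> to the nearer endpoint increases no
  distance, so a global minimizer \<open>b\<close> exists in \<open>[x 1, x n]\<close>. If
  \<open>b\<close> is neither a data point nor a midpoint, distances from \<open>b\<close> to distinct
  data values are distinct and positive. One permutation then sorts the distances throughout a
  neighbourhood of \<open>b\<close>, the objective is differentiable there, and its derivative
  vanishes at \<open>b\<close>.
\<close>

text \<open>Induction on both lists at once, comparing each new element with the head of its list.
  If only one of them goes to the front, the other list's old head takes over as the inserted
  element.\<close>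

lemma list_all2_insort:
  fixes xs ys :: "'a::linorder list"
  assumes "list_all2 (\<le>) xs ys" "sorted xs" "sorted ys" "a \<le> b"
  shows "list_all2 (\<le>) (insort a xs) (insort b ys)"
  using assms
proof (induction xs ys arbitrary: a b rule: list_all2_induct)
  case Nil
  then show ?case by simp
next
  case (Cons x xs y ys)
  \<comment> \<open>A sorted list is its head inserted into its tail. In the mixed cases the
    hypothesis therefore applies to the pair \<open>x\<close>, \<open>b\<close> (as x \<le> y < b)
    or \<open>a\<close>, \<open>y\<close> (as a \<le> b \<le> y).\<close>
  have sorted: "sorted xs" "sorted ys" "insort x xs = x # xs" "insort y ys = y # ys"
    using Cons.prems by (auto simp: insort_is_Cons)
  note step = Cons.IH[OF sorted(1,2)]
  consider "a \<le> x" "b \<le> y" | "a \<le> x" "y < b" | "x < a" "b \<le> y" | "x < a" "y < b"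
    by force
  then show ?case
  proof cases
    case 1
    then show ?thesis using Cons by simp
  next
    case 2
    then show ?thesis using Cons.hyps step[of x b] sorted by auto
  next
    case 3
    then show ?thesis using Cons.prems step[of a y] sorted by auto
  next
    case 4
    then show ?thesis using Cons.hyps Cons.prems step[of a b] by auto
  qed
qed

text \<open>\<open>sort\<close> is iterated \<open>insort\<close>, so the insertion lemma makes
  every order statistic monotone in the data.\<close>

lemma list_all2_sort:
  fixes xs ys :: "'a::linorder list"
  assumes "list_all2 (\<le>) xs ys"
  shows "list_all2 (\<le>) (sort xs) (sort ys)"
  using assms
  by (induction rule: list_all2_induct) (auto intro!: list_all2_insort)

lemma sort_map_mono:
  fixes f :: "'a::linorder \<Rightarrow> 'b::linorder"
  assumes "mono f"
  shows "sort (map f xs) = map f (sort xs)"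
proof (rule properties_for_sort)
  show "sorted (map f (sort xs))"
    using assms by (auto simp: sorted_map monoD intro: sorted_wrt_mono_rel[OF _ sorted_sort])
qed simp

text \<open>Adding a constant commutes with sorting, so a uniform bound on the distances survives
  it. Taking \<open>d\<close> as the distance of the two points gives continuity; \<open>d\<close> =
  0 gives monotonicity.\<close>

lemma sorted_dist_le:
  assumes "\<And>j. j \<in> {1..n} \<Longrightarrow> \<bar>x j - b\<bar> \<le> \<bar>x j - c\<bar> + d" "i \<in> {1..n}"
  shows "sorted_dist n x b i \<le> sorted_dist n x c i + d"
proof -
  let ?xs = "\<lambda>c. map (\<lambda>j. \<bar>x j - c\<bar>) [1..<Suc n]"
  have "list_all2 (\<le>) (?xs b) (map (\<lambda>t. t + d) (?xs c))"
    using assms(1) by (auto simp: list_all2_conv_all_nth simp del: upt_Suc)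
  then have "list_all2 (\<le>) (sort (?xs b)) (map (\<lambda>t. t + d) (sort (?xs c)))"
    by (subst sort_map_mono[symmetric]) (auto intro!: monoI list_all2_sort simp del: upt_Suc)
  then show ?thesis
    using assms(2) unfolding sorted_dist_def
    by (auto dest!: list_all2_nthD[of _ _ _ "i - 1"] simp del: upt_Suc)
qed

lemma sorted_dist_nonneg:
  assumes "i \<in> {1..n}"
  shows "0 \<le> sorted_dist n x b i"
proof -
  let ?xs = "map (\<lambda>j. \<bar>x j - b\<bar>) [1..<Suc n]"
  have "sort ?xs ! (i - 1) \<in> set (sort ?xs)"
    using assms by (intro nth_mem) (auto simp del: upt_Suc)
  then show ?thesis
    by (auto simp: sorted_dist_def simp del: upt_Suc)
qed

lemma continuous_on_sorted_dist:
  assumes "i \<in> {1..n}"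
  shows "continuous_on S (\<lambda>b. sorted_dist n x b i)"
  unfolding continuous_on_def
proof
  fix b
  have "sorted_dist n x b i \<le> sorted_dist n x c i + \<bar>b - c\<bar>" for b c
    by (rule sorted_dist_le) (use assms in auto)
  \<comment> \<open>Exchanging the two points turns the one-sided bound into the Lipschitz
    estimate.\<close>
  from this[of b] this[of _ b]
  have "dist (sorted_dist n x c i) (sorted_dist n x b i) \<le> dist c b" for c
    by (smt (verit) dist_real_def)
  then show "((\<lambda>b. sorted_dist n x b i) \<longlongrightarrow> sorted_dist n x b i) (at b within S)"
    by (intro metric_tendsto_imp_tendsto[OF tendsto_ident_at]) auto
qed

text \<open>At a data point the smallest distance is 0, and a fixed power is continuous at base 0
  only for a positive exponent.\<close>

lemma continuous_on_ordered_median_fun: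
  assumes "p > 0"
  shows "continuous_on S (ordered_median_fun n x lam p)"
  unfolding ordered_median_fun_def[abs_def]
  by (intro continuous_intros continuous_on_powr' continuous_on_sorted_dist)
     (use assms in \<open>auto intro: sorted_dist_nonneg\<close>)

lemma ordered_median_fun_mono:
  assumes "\<And>j. j \<in> {1..n} \<Longrightarrow> \<bar>x j - b\<bar> \<le> \<bar>x j - c\<bar>"
    and "\<And>i. i \<in> {1..n} \<Longrightarrow> lam i \<ge> 0" "p \<ge> 0"
  shows "ordered_median_fun n x lam p b \<le> ordered_median_fun n x lam p c"
  unfolding ordered_median_fun_def
  using assms sorted_dist_le[of n x b c 0]
  by (intro sum_mono mult_left_mono powr_mono2) (auto intro: sorted_dist_nonneg)

lemma ex_ordered_median_point:
  assumes "n \<ge> 1" and mono: "mono_on {1..n} x"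
    and "\<And>i. i \<in> {1..n} \<Longrightarrow> lam i \<ge> 0" "p > 0"
  obtains b where "b \<in> {x 1..x n}" "is_ordered_median_point n x lam p b"
proof -
  let ?f = "ordered_median_fun n x lam p"
  have le: "x 1 \<le> x j" "x j \<le> x n" if "j \<in> {1..n}" for j
    using that by (auto intro: mono_onD[OF mono])
  have "x 1 \<le> x n"
    using le[of n] \<open>n \<ge> 1\<close> by simp
  then obtain b where b: "b \<in> {x 1..x n}" "\<And>c. c \<in> {x 1..x n} \<Longrightarrow> ?f b \<le> ?f c"
    using continuous_attains_inf[OF compact_Icc _ continuous_on_ordered_median_fun[OF \<open>p > 0\<close>],
        of "x 1" "x n" n x lam]
    by auto
  have "?f b \<le> ?f c" for c
  proof -
    \<comment> \<open>The point of the interval nearest to \<open>c\<close>: all data lie in the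
      interval, so no distance grows.\<close>
    define c' where "c' = max (x 1) (min (x n) c)"
    have "?f b \<le> ?f c'"
      using \<open>x 1 \<le> x n\<close> by (intro b) (auto simp: c'_def)
    also have "\<dots> \<le> ?f c"
    proof (rule ordered_median_fun_mono)
      show "\<bar>x j - c'\<bar> \<le> \<bar>x j - c\<bar>" if "j \<in> {1..n}" for j
        using le[OF that] by (auto simp: c'_def max_def min_def)
    qed (use assms in auto)
    finally show ?thesis .
  qed
  with b(1) show ?thesis
    by (intro that) (auto simp: is_ordered_median_point_def)
qed

text \<open>Ties between equal data values persist under perturbation; strict comparisons persist by
  continuity.\<close>

lemma eventually_sorted_dist_eq:
  assumes "\<And>j k. j \<in> {1..n} \<Longrightarrow> k \<in> {1..n} \<Longrightarrow> \<bar>x j - b\<bar> = \<bar>x k - b\<bar> \<Longrightarrow> x j = x k"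
  obtains r where "r ` {1..n} \<subseteq> {1..n}"
    "\<forall>\<^sub>F c in nhds b. \<forall>i\<in>{1..n}. sorted_dist n x c i = \<bar>x (r i) - c\<bar>"
proof -
  \<comment> \<open>Indices ordered by distance from \<open>b\<close>; this one list is shown to
    order the distances from every nearby \<open>c\<close> too.\<close>
  define zs where "zs = sort_key (\<lambda>j. \<bar>x j - b\<bar>) [1..<Suc n]"
  have zs: "set zs = {1..n}" "length zs = n" "mset zs = mset [1..<Suc n]"
    by (auto simp: zs_def simp del: upt_Suc)
  have "\<forall>\<^sub>F c in nhds b. \<forall>j\<in>{1..n}. \<forall>k\<in>{1..n}.
      \<bar>x j - b\<bar> \<le> \<bar>x k - b\<bar> \<longrightarrow> \<bar>x j - c\<bar> \<le> \<bar>x k - c\<bar>"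
  proof (intro eventually_ball_finite ballI finite_atLeastAtMost)
    fix j k
    assume jk: "j \<in> {1..n}" "k \<in> {1..n}"
    have "((\<lambda>c. \<bar>x i - c\<bar>) \<longlongrightarrow> \<bar>x i - b\<bar>) (nhds b)" for i
      by (intro tendsto_intros filterlim_ident)
    then have "\<forall>\<^sub>F c in nhds b. 0 < \<bar>x k - c\<bar> - \<bar>x j - c\<bar>" if "\<bar>x j - b\<bar> < \<bar>x k - b\<bar>"
      using that by (intro order_tendstoD(1)[OF tendsto_diff]) auto
    then have less: "\<forall>\<^sub>F c in nhds b. \<bar>x j - c\<bar> \<le> \<bar>x k - c\<bar>" if "\<bar>x j - b\<bar> < \<bar>x k - b\<bar>"
      using that by (auto elim!: eventually_mono)
    show "\<forall>\<^sub>F c in nhds b. \<bar>x j - b\<bar> \<le> \<bar>x k - b\<bar> \<longrightarrow> \<bar>x j - c\<bar> \<le> \<bar>x k - c\<bar>"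
      using less assms[OF jk] by (cases "\<bar>x j - b\<bar>" "\<bar>x k - b\<bar>" rule: linorder_cases) auto
  qed
  then have "\<forall>\<^sub>F c in nhds b. \<forall>i\<in>{1..n}. sorted_dist n x c i = \<bar>x (zs ! (i - 1)) - c\<bar>"
  proof eventually_elim
    case (elim c)
    have "sorted (map (\<lambda>j. \<bar>x j - b\<bar>) zs)"
      by (simp add: zs_def del: upt_Suc)
    then have "sorted (map (\<lambda>j. \<bar>x j - c\<bar>) zs)"
      using elim zs(1) unfolding sorted_map
      by (auto elim!: sorted_wrt_mono_rel[rotated])
    \<comment> \<open>A sorted list is determined by its multiset, and \<open>zs\<close> permutes
      the indices.\<close>
    then have "sort (map (\<lambda>j. \<bar>x j - c\<bar>) [1..<Suc n]) = map (\<lambda>j. \<bar>x j - c\<bar>) zs"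
      using zs(3) by (intro properties_for_sort) (simp_all del: upt_Suc)
    then show ?case
      by (auto simp: sorted_dist_def zs(2) simp del: upt_Suc)
  qed
  moreover have "(\<lambda>i. zs ! (i - 1)) ` {1..n} \<subseteq> {1..n}"
    using nth_mem[of _ zs] zs(1,2) by (force simp del: nth_mem)
  ultimately show ?thesis
    by (intro that)
qed

text \<open>Near \<open>b\<close> the sign \<open>s\<close> of \<open>a - c\<close> is constant, so
  the absolute value is the positive affine function \<open>s * (a - c)\<close>, whose real powers
  are all differentiable.\<close>

lemma differentiable_abs_diff_powr:
  fixes a b p :: real
  assumes "a \<noteq> b"
  shows "(\<lambda>c. \<bar>a - c\<bar> powr p) differentiable (at b)"
proof -
  define s where "s = sgn (a - b)"
  have "s * (a - b) > 0"
    using assms by (auto simp: s_def sgn_if)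
  then have "\<forall>\<^sub>F c in nhds b. s * (a - c) > 0"
    by (rule order_tendstoD(1)[rotated]) (intro tendsto_intros filterlim_ident)
  then have ev: "\<forall>\<^sub>F c in nhds b. \<bar>a - c\<bar> powr p = (s * (a - c)) powr p"
    by eventually_elim (auto simp: s_def sgn_if split: if_splits)
  have "((\<lambda>c. (s * (a - c)) powr p) has_real_derivative
      p * (s * (a - b)) powr (p - 1) * - s) (at b)"
    using \<open>s * (a - b) > 0\<close>
    by (auto intro!: derivative_eq_intros simp: powr_diff)
  then show ?thesis
    using DERIV_cong_ev[OF refl ev refl] unfolding real_differentiable_def by blast
qed

lemma ordered_median_fun_differentiable:
  assumes "b \<in> {x 1<..<x n}" "b \<notin> data_and_midpoints n x"
  shows "\<exists>D. (ordered_median_fun n x lam p has_real_derivative D) (at b)"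
proof -
  have ne: "x j \<noteq> b" if "j \<in> {1..n}" for j
    using assms(2) that by (auto simp: data_and_midpoints_def)
  have mid: "b \<noteq> (x j + x k) / 2" if "j \<in> {1..n}" "k \<in> {1..n}" "j < k" for j k
  proof
    assume "b = (x j + x k) / 2"
    \<comment> \<open>Since \<open>b\<close> is interior, the midpoint meets the open-interval
      condition in the definition.\<close>
    then have "\<exists>i k. b = (x i + x k) / 2 \<and> 1 \<le> i \<and> i < k \<and> k \<le> n \<and> (x i + x k) / 2 \<in> {x 1<..<x n}"
      using that assms(1) by (intro exI[of _ j] exI[of _ k]) simp
    then have "b \<in> data_and_midpoints n x"
      unfolding data_and_midpoints_def by (intro UnI2 CollectI)
    with assms(2) show False ..
  qed
  \<comment> \<open>Equal distances mean equal values or that \<open>b\<close> is the midpoint.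
    Midpoints are indexed by increasing pairs, so both orders of \<open>j\<close>, \<open>k\<close>
    are tried.\<close>
  have "x j = x k" if "j \<in> {1..n}" "k \<in> {1..n}" "\<bar>x j - b\<bar> = \<bar>x k - b\<bar>" for j k
    using mid[of j k] mid[of k j] that
    by (cases j k rule: linorder_cases) (auto simp: abs_if field_simps split: if_splits)
  then obtain r where r: "r ` {1..n} \<subseteq> {1..n}"
    and ev: "\<forall>\<^sub>F c in nhds b. \<forall>i\<in>{1..n}. sorted_dist n x c i = \<bar>x (r i) - c\<bar>"
    using eventually_sorted_dist_eq[of n x b] by blast
  have "(\<lambda>c. \<bar>x (r i) - c\<bar> powr p) differentiable (at b)" if "i \<in> {1..n}" for i
    using ne r that by (intro differentiable_abs_diff_powr) blast
  then have "(\<lambda>c. \<Sum>i=1..n. lam i * \<bar>x (r i) - c\<bar> powr p) differentiable (at b)"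
    by (intro differentiable_sum differentiable_mult) auto
  then obtain D where
    "((\<lambda>c. \<Sum>i=1..n. lam i * \<bar>x (r i) - c\<bar> powr p) has_real_derivative D) (at b)"
    by (auto simp: real_differentiable_def)
  moreover have "\<forall>\<^sub>F c in nhds b.
      ordered_median_fun n x lam p c = (\<Sum>i=1..n. lam i * \<bar>x (r i) - c\<bar> powr p)"
    using ev by eventually_elim (simp add: ordered_median_fun_def)
  ultimately show ?thesis
    by (auto simp: DERIV_cong_ev[OF refl _ refl])
qed

theorem theorem11:
  fixes n :: nat and x lam :: "nat \<Rightarrow> real" and p :: real
  assumes "n \<ge> 1"
    and "mono_on {1..n} x"
    and "\<And>i. i \<in> {1..n} \<Longrightarrow> lam i \<ge> 0"
    and "p \<ge> 1"
  shows "\<exists>b \<in> data_and_midpoints n x \<union> critical_points n x lam p.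
           is_ordered_median_point n x lam p b"
proof -
  have "p > 0"
    using \<open>p \<ge> 1\<close> by simp
  with assms obtain b where b: "b \<in> {x 1..x n}" "is_ordered_median_point n x lam p b"
    using ex_ordered_median_point by metis
  have "b \<in> critical_points n x lam p" if notin: "b \<notin> data_and_midpoints n x"
  proof -
    \<comment> \<open>Both endpoints are data points, so the minimizer lies in the open
      interval.\<close>
    have "b \<noteq> x 1" "b \<noteq> x n"
      using notin \<open>n \<ge> 1\<close> by (auto simp: data_and_midpoints_def)
    with b(1) have int: "b \<in> {x 1<..<x n}"
      by auto
    then obtain D where D: "(ordered_median_fun n x lam p has_real_derivative D) (at b)"
      using ordered_median_fun_differentiable[of b x n lam p] notin by blast
    \<comment> \<open>The minimum is global, so any radius works; 1 is arbitrary.\<close>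
    have "D = 0"
      by (rule DERIV_local_min[OF D zero_less_one])
        (use b(2) in \<open>auto simp: is_ordered_median_point_def\<close>)
    with int D show ?thesis
      by (simp add: critical_points_def)
  qed
  with b(2) show ?thesis
    by blast
qed

end
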